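(* Let $f\in\Gamma_0(\mathcal H)$ be continuously differentiable with non-empty set of minimizers $\Omega$ and minimum value $f^*$, and let $(X(t),Z(t))$, $t\ge 0$, be the solution to $$Z=b_t\dot X+c_tL^{-1}\nabla f(X)+X,\qquad \dot Z=-a_tL^{-1}\nabla f(X),\qquad Z(0)=X(0)=x_0 .$$ Suppose that $A_t=a_tb_t$ and $0\le \dot A_t\le a_t$. For $x^*\in\Omega$ put $$\mathcal E(t):=A_t\,[f(X(t))-f(x^* )]+\tfrac12\|Z(t)-x^*\|_L^2 .$$ Then $\mathcal E(t)$ is non-increasing, and for all $t>0$ $$f(X(t))-f^*\le \frac{A_0}{A_t}[f(x_0)-f^*]+\frac{\mathrm{dist}_L(x_0,\Omega)^2}{2A_t}.$$ Additionally, $$\int_0^\infty (a_t-\dot A_t)\langle\nabla f(X(t)),X(t)-x^*\rangle\,dt\le A_0[f(x_0)-f^*]+\tfrac12\|x_0-x^*\|_L^2\qquad\text{for all }x^*\in\Omega,$$ $$\int_0^\infty a_tc_t\|\nabla f(X(t))\|_{L^{-1}}^2\,dt\le A_0[f(x_0)-f^*]+\tfrac12\mathrm{dist}_L(x_0,\Omega)^2 .$$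
   Context: $\mathcal H$ is a real Hilbert space with inner product $\langle\cdot,\cdot\rangle$ and norm $\|\cdot\|$. $\Gamma_0(\mathcal H)$ is the set of closed, proper, convex functions on $\mathcal H$. $L:\mathcal H\to\mathcal H$ is a positive definite operator (bounded, linear, self-adjoint, with inverse $L^{-1}$ defined on $\mathcal H$); $\langle x,y\rangle_L=\langle Lx,y\rangle$, $\|x\|_L=\sqrt{\langle Lx,x\rangle}$, and $\|x\|_{L^{-1}}=\sqrt{\langle L^{-1}x,x\rangle}$. $\mathrm{dist}_L(x_0,\Omega)=\inf_{x\in\Omega}\|x_0-x\|_L$. The coefficients $a_t,b_t,c_t$ are real functions of $t\in[0,\infty)$, positive on $(0,\infty)$ and non-negative at $0$, and $a_tb_t$ is differentiable in $t$. A dot denotes the derivative in $t$. A solution is a pair of functions $X,Z:[0,\infty)\to\mathcal H$, continuous on $[0,\infty)$ and differentiable on $(0,\infty)$, satisfying the system for $t>0$ and the initial condition. *)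

theory Defs
  imports "HOL-Analysis.Analysis"
begin

definition epigraph :: "('a \<Rightarrow> ereal) \<Rightarrow> ('a \<times> real) set" where
  "epigraph F = {(x, r). F x \<le> ereal r}"

text \<open>Closed (that is, with closed epigraph, equivalently lower semicontinuous), proper,
  convex extended-real-valued functions.\<close>

definition Gamma0 :: "('a::real_normed_vector \<Rightarrow> ereal) set" where
  "Gamma0 = {F. closed (epigraph F) \<and> convex (epigraph F)
               \<and> (\<forall>x. F x \<noteq> - \<infinity>) \<and> (\<exists>x. F x \<noteq> \<infinity>)}"

definition grad :: "('a::real_inner \<Rightarrow> real) \<Rightarrow> 'a \<Rightarrow> 'a" where
  "grad f x = (THE g. GDERIV f x :> g)"

definition continuously_differentiable :: "('a::real_inner \<Rightarrow> real) \<Rightarrow> bool" where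
  "continuously_differentiable f \<longleftrightarrow>
     (\<forall>x. \<exists>g. GDERIV f x :> g) \<and> continuous_on UNIV (grad f)"

definition minimizers :: "('a \<Rightarrow> real) \<Rightarrow> 'a set" where
  "minimizers f = {x. \<forall>y. f x \<le> f y}"

text \<open>Meaningful only when the minimum is attained.\<close>

definition min_value :: "('a \<Rightarrow> real) \<Rightarrow> real" where
  "min_value f = (INF x. f x)"

text \<open>The inverse is only required to be defined everywhere; it is then the
  function \<open>inv L\<close>, whose boundedness is not part of the definition.\<close>

definition positive_definite_op :: "('a::real_inner \<Rightarrow> 'a) \<Rightarrow> bool" where
  "positive_definite_op L \<longleftrightarrow>
     bounded_linear L \<and> (\<forall>x y. inner (L x) y = inner x (L y))
     \<and> (\<forall>x. x \<noteq> 0 \<longrightarrow> inner (L x) x > 0) \<and> bij L"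

definition norm_op :: "('a::real_inner \<Rightarrow> 'a) \<Rightarrow> 'a \<Rightarrow> real" where
  "norm_op L x = sqrt (inner (L x) x)"

definition dist_op :: "('a::real_inner \<Rightarrow> 'a) \<Rightarrow> 'a \<Rightarrow> 'a set \<Rightarrow> real" where
  "dist_op L x0 S = (INF x\<in>S. norm_op L (x0 - x))"

text \<open>The coefficients and trajectories are functions on \<open>[0, \<infinity>)\<close>; their values at negative
  arguments are never used.\<close>

definition ode_solution ::
  "(real \<Rightarrow> real) \<Rightarrow> (real \<Rightarrow> real) \<Rightarrow> (real \<Rightarrow> real) \<Rightarrow> ('a::real_inner \<Rightarrow> 'a) \<Rightarrow> ('a \<Rightarrow> real)
    \<Rightarrow> 'a \<Rightarrow> (real \<Rightarrow> 'a) \<Rightarrow> (real \<Rightarrow> 'a) \<Rightarrow> bool" where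
  "ode_solution a b c L f x0 X Z \<longleftrightarrow>
     continuous_on {0..} X \<and> continuous_on {0..} Z
     \<and> (\<forall>t>0. X differentiable (at t) \<and> Z differentiable (at t))
     \<and> (\<forall>t>0. Z t = b t *\<^sub>R vector_derivative X (at t) + c t *\<^sub>R inv L (grad f (X t)) + X t)
     \<and> (\<forall>t>0. vector_derivative Z (at t) = - (a t *\<^sub>R inv L (grad f (X t))))
     \<and> Z 0 = x0 \<and> X 0 = x0"

definition energy ::
  "(real \<Rightarrow> real) \<Rightarrow> ('a::real_inner \<Rightarrow> 'a) \<Rightarrow> ('a \<Rightarrow> real) \<Rightarrow> (real \<Rightarrow> 'a) \<Rightarrow> (real \<Rightarrow> 'a)
    \<Rightarrow> 'a \<Rightarrow> real \<Rightarrow> real" where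
  "energy A L f X Z xs t = A t * (f (X t) - f xs) + 1 / 2 * (norm_op L (Z t - xs))\<^sup>2"

end

theory Submission
  imports Defs
begin

text \<open>
  Along a solution, for a minimizer \<open>x\<^sup>*\<close> and with \<open>g = \<nabla>f(X)\<close>, the two equations make every
  mixed term of the derivative of the energy cancel.  On \<open>t > 0\<close>,
  \<open>\<E>' = A' (f(X) - f(x\<^sup>*)) + A \<langle>g, X'\<rangle> + \<langle>L Z', Z - x\<^sup>*\<rangle>\<close>;
  here \<open>L Z' = - a g\<close>, and \<open>A X' = a (b X') = a (Z - X - c L\<^sup>-\<^sup>1 g)\<close>, so that
  \<open>- \<E>' = A' (\<langle>g, X - x\<^sup>*\<rangle> - (f(X) - f(x\<^sup>*))) + (a - A') \<langle>g, X - x\<^sup>*\<rangle> + a c \<parallel>g\<parallel>\<^sup>2\<close>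
  in the norm of \<open>L\<^sup>-\<^sup>1\<close>.  By convexity and \<open>0 \<le> A' \<le> a\<close> each of the three summands is
  nonnegative.  Hence \<open>\<E>\<close> decreases, which gives the rate after dropping the distance term
  from \<open>\<E>(t) \<le> \<E>(0)\<close>, and the last two summands have integral at most \<open>\<E>(0)\<close>
  because \<open>\<E> \<ge> 0\<close>.  Where the bound does not depend on \<open>x\<^sup>*\<close>, the infimum
  over the minimizers replaces \<open>\<parallel>x\<^sub>0 - x\<^sup>*\<parallel>\<close> by the distance.

  Two analytic points need care.  The energy is differentiable only for \<open>t > 0\<close> and merely
  continuous at \<open>0\<close>, and its derivative need not be continuous; the lemma
  \<open>dissipation_integral_bound\<close> therefore rests on the gauge integral.  Moreover the
  coefficients \<open>a\<close> and \<open>c\<close> may fail to be measurable at times when \<open>g\<close> vanishes.  The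
  integrands are measurable nevertheless, because the equations express them through
  derivatives of the trajectory: \<open>a g = - L Z'\<close>, and
  \<open>a c \<parallel>g\<parallel>\<^sup>2 = - \<langle>L Z', Z - X\<rangle> - A (f \<circ> X)'\<close>.
\<close>

section \<open>Gradients of convex functions\<close>

lemma GDERIV_unique:
  assumes "GDERIV f x :> g" and "GDERIV f x :> h"
  shows "g = h"
proof -
  have "(\<lambda>v. inner v g) = (\<lambda>v. inner v h)"
    using assms unfolding gderiv_def by (rule has_derivative_unique)
  then have "inner (g - h) g = inner (g - h) h"
    by (rule fun_cong)
  then have "inner (g - h) (g - h) = 0"
    by (simp only: inner_diff_right)
  then show ?thesis by simp
qed

lemma GDERIV_grad:
  assumes "continuously_differentiable f"
  shows "GDERIV f x :> grad f x"
proof -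
  obtain g where g: "GDERIV f x :> g"
    using assms unfolding continuously_differentiable_def by blast
  have "grad f x = g"
    unfolding grad_def using g by (blast intro: the_equality GDERIV_unique)
  with g show ?thesis by simp
qed

lemma GDERIV_chain_real:
  fixes X :: "real \<Rightarrow> 'a::real_inner"
  assumes f: "GDERIV f (X t) :> g" and X: "(X has_vector_derivative X') (at t)"
  shows "((\<lambda>s. f (X s)) has_real_derivative inner g X') (at t)"
proof -
  have "((\<lambda>s. f (X s)) has_derivative (\<lambda>h. inner (h *\<^sub>R X') g)) (at t)"
    using has_derivative_compose[OF X[unfolded has_vector_derivative_def] f[unfolded gderiv_def]] .
  moreover have "(\<lambda>h. inner (h *\<^sub>R X') g) = (*) (inner g X')"
    by (auto simp: inner_commute)
  ultimately show ?thesis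
    by (simp add: has_field_derivative_def)
qed

lemma Gamma0_real_convex:
  fixes f :: "'a::real_normed_vector \<Rightarrow> real"
  assumes "(\<lambda>x. ereal (f x)) \<in> Gamma0"
  shows "convex_on UNIV f"
proof (rule convex_onI)
  fix t :: real and x y :: 'a
  assume t: "0 < t" "t < 1"
  have cvx: "convex (epigraph (\<lambda>x. ereal (f x)))"
    using assms by (simp add: Gamma0_def)
  have "(1 - t) *\<^sub>R (x, f x) + t *\<^sub>R (y, f y) \<in> epigraph (\<lambda>x. ereal (f x))"
    by (rule convexD[OF cvx]) (use t in \<open>auto simp: epigraph_def\<close>)
  then show "f ((1 - t) *\<^sub>R x + t *\<^sub>R y) \<le> (1 - t) * f x + t * f y"
    by (simp add: epigraph_def)
qed simp

text \<open>The difference quotients of \<open>f\<close> at \<open>x\<close> along the segment to \<open>y\<close> are at most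
  \<open>f y - f x\<close> by convexity, and they tend to the directional derivative.\<close>

lemma convex_above_tangent_GDERIV:
  fixes f :: "'a::real_inner \<Rightarrow> real"
  assumes f: "convex_on UNIV f" and g: "GDERIV f x :> g"
  shows "f x + inner g (y - x) \<le> f y"
proof -
  define \<phi> where "\<phi> s = f (x + s *\<^sub>R (y - x))" for s :: real
  have "((\<lambda>s. x + s *\<^sub>R (y - x)) has_vector_derivative (y - x)) (at 0)"
    by (auto intro!: derivative_eq_intros)
  then have "(\<phi> has_real_derivative inner g (y - x)) (at 0)"
    unfolding \<phi>_def by (intro GDERIV_chain_real) (use g in auto)
  then have "((\<lambda>s. (\<phi> s - \<phi> 0) / (s - 0)) \<longlongrightarrow> inner g (y - x)) (at 0)"
    by (rule has_field_derivativeD)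
  then have lim: "((\<lambda>s. (\<phi> s - \<phi> 0) / (s - 0)) \<longlongrightarrow> inner g (y - x)) (at_right 0)"
    by (rule tendsto_within_subset) simp
  have quotient: "(\<phi> s - \<phi> 0) / (s - 0) \<le> f y - f x" if s: "0 < s" "s < 1" for s
  proof -
    have "\<phi> s = f ((1 - s) *\<^sub>R x + s *\<^sub>R y)"
      by (simp add: \<phi>_def algebra_simps)
    also have "\<dots> \<le> (1 - s) * f x + s * f y"
      by (rule convex_onD[OF f]) (use s in auto)
    finally show ?thesis
      using s by (simp add: \<phi>_def field_simps)
  qed
  have "\<forall>\<^sub>F s in at_right 0. (\<phi> s - \<phi> 0) / (s - 0) \<le> f y - f x"
    unfolding eventually_at_right_field using quotient by (intro exI[of _ 1]) auto
  then have "inner g (y - x) \<le> f y - f x"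
    using lim by (intro tendsto_upperbound) auto
  then show ?thesis by simp
qed

lemma min_value_eq:
  assumes "xs \<in> minimizers f"
  shows "min_value f = f xs"
  unfolding min_value_def
  by (rule cInf_eq_minimum) (use assms in \<open>auto simp: minimizers_def\<close>)

section \<open>Positive definite operators\<close>

lemma positive_definite_op_nonneg:
  assumes "positive_definite_op L"
  shows "inner (L x) x \<ge> 0"
proof -
  have "L 0 = 0"
    using assms by (auto simp: positive_definite_op_def intro: linear_0 bounded_linear.linear)
  then show ?thesis
    using assms by (cases "x = 0") (auto simp: positive_definite_op_def less_imp_le)
qed

lemma norm_op_sq:
  assumes "positive_definite_op L"
  shows "(norm_op L x)\<^sup>2 = inner (L x) x"
  using positive_definite_op_nonneg[OF assms] by (simp add: norm_op_def)

lemma positive_definite_op_inv: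
  assumes "positive_definite_op L"
  shows "L (inv L x) = x"
  using assms by (simp add: positive_definite_op_def bij_is_surj surj_f_inv_f)

lemma norm_op_inv_sq:
  assumes "positive_definite_op L"
  shows "(norm_op (inv L) x)\<^sup>2 = inner (inv L x) x"
proof -
  have "inner (inv L x) x = (norm_op L (inv L x))\<^sup>2"
    by (simp add: norm_op_sq[OF assms] positive_definite_op_inv[OF assms] inner_commute)
  then show ?thesis
    by (simp add: norm_op_def)
qed

text \<open>Squaring is monotone on nonnegative numbers, so that the infimum defining the distance
  may be taken inside the square.\<close>

lemma le_dist_op_sq:
  assumes L: "positive_definite_op L" and "S \<noteq> {}"
    and bound: "\<And>x. x \<in> S \<Longrightarrow> r \<le> (norm_op L (x0 - x))\<^sup>2"
  shows "r \<le> (dist_op L x0 S)\<^sup>2"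
proof -
  have nonneg: "norm_op L y \<ge> 0" for y
    using positive_definite_op_nonneg[OF L] by (simp add: norm_op_def)
  define \<rho> where "\<rho> = sqrt (max 0 r)"
  have "\<rho> \<le> norm_op L (x0 - x)" if "x \<in> S" for x
    unfolding \<rho>_def by (rule real_le_lsqrt) (use nonneg bound[OF that] in auto)
  then have "\<rho> \<le> dist_op L x0 S"
    unfolding dist_op_def using \<open>S \<noteq> {}\<close> by (intro cINF_greatest)
  then have "\<rho>\<^sup>2 \<le> (dist_op L x0 S)\<^sup>2"
    by (rule power_mono) (simp add: \<rho>_def)
  then show ?thesis
    by (simp add: \<rho>_def)
qed

section \<open>Measurability of derivatives and integration of a dissipation rate\<close>

text \<open>A derivative is the pointwise limit of difference quotients.  Pairing with \<open>w\<close> first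
  keeps everything real-valued: in a nonseparable space, sums of vector-valued Borel
  functions need not be Borel.\<close>

lemma borel_measurable_inner_derivative:
  fixes Y D w :: "real \<Rightarrow> 'a::real_inner"
  assumes Y: "\<And>t. t > 0 \<Longrightarrow> (Y has_vector_derivative D t) (at t)"
    and w: "continuous_on {0<..} w"
  shows "(\<lambda>t. indicator {0<..} t * inner (D t) (w t)) \<in> borel_measurable borel"
proof -
  define q where "q n t = real (Suc n) * inner (Y (t + 1 / real (Suc n)) - Y t) (w t)" for n t
  have contY: "continuous_on {0<..} Y"
    using Y by (auto intro!: continuous_at_imp_continuous_on has_vector_derivative_continuous)
  have "continuous_on {0<..} (\<lambda>t. Y (t + 1 / real (Suc n)))" for n
    by (rule continuous_on_compose2[OF contY]) (auto intro!: continuous_intros add_pos_pos)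
  then have "continuous_on {0<..} (q n)" for n
    unfolding q_def by (intro continuous_intros contY w)
  then have meas: "(\<lambda>t. indicator {0<..} t *\<^sub>R q n t) \<in> borel_measurable borel" for n
    by (intro borel_measurable_continuous_on_indicator) auto
  have lim: "(\<lambda>n. q n t) \<longlonglongrightarrow> inner (D t) (w t)" if "t > 0" for t
  proof -
    have "((\<lambda>s. inner (Y s) (w t)) has_real_derivative inner (D t) (w t)) (at t)"
      unfolding has_real_derivative_iff_has_vector_derivative
      by (rule bounded_linear.has_vector_derivative[OF bounded_linear_inner_left Y[OF that]])
    then have "((\<lambda>h. (inner (Y (t + h)) (w t) - inner (Y t) (w t)) / h) \<longlongrightarrow> inner (D t) (w t)) (at 0)"
      by (rule DERIV_D)
    moreover have "filterlim (\<lambda>n. 1 / real (Suc n)) (at 0) sequentially"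
      unfolding filterlim_at using LIMSEQ_inverse_real_of_nat
      by (auto simp: inverse_eq_divide)
    ultimately have "(\<lambda>n. (inner (Y (t + 1 / real (Suc n))) (w t) - inner (Y t) (w t))
        / (1 / real (Suc n))) \<longlonglongrightarrow> inner (D t) (w t)"
      by (rule filterlim_compose)
    then show ?thesis
      by (simp add: q_def inner_diff_left mult.commute)
  qed
  show ?thesis
  proof (rule borel_measurable_LIMSEQ_real[OF _ meas])
    show "(\<lambda>n. indicator {0<..} t *\<^sub>R q n t) \<longlonglongrightarrow> indicator {0<..} t * inner (D t) (w t)" for t
      using lim[of t] by (cases "t > 0") auto
  qed
qed

text \<open>The gauge integral satisfies the fundamental theorem for every derivative, continuous or
  not, and for nonnegative integrands it agrees with the Lebesgue integral.  This gives the bound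
  on bounded intervals, from which monotone convergence passes to the half-line.\<close>

lemma dissipation_integral_bound:
  fixes E E' h :: "real \<Rightarrow> real"
  assumes cont: "continuous_on {0..} E"
    and deriv: "\<And>t. t > 0 \<Longrightarrow> (E has_real_derivative E' t) (at t)"
    and nonneg: "\<And>t. t > 0 \<Longrightarrow> E t \<ge> 0"
    and rate: "\<And>t. t > 0 \<Longrightarrow> 0 \<le> h t \<and> h t \<le> - E' t"
    and meas: "(\<lambda>t. indicator {0<..} t * h t) \<in> borel_measurable borel"
  shows "set_integrable lborel {0..} h" and "(LINT t:{0..}|lborel. h t) \<le> E 0"
proof -
  define H where "H t = indicator {0<..} t * h t" for t
  have [measurable]: "H \<in> borel_measurable borel"
    using meas unfolding H_def .
  have bound: "(\<integral>\<^sup>+t. ennreal (H t) * indicator {0<..<real n} t \<partial>lborel) \<le> ennreal (E 0)" for n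
  proof (cases "n = 0")
    case False
    have "((\<lambda>t. - E' t) has_integral (- E (real n) - - E 0)) {0..real n}"
    proof (rule fundamental_theorem_of_calculus_interior)
      show "continuous_on {0..real n} (\<lambda>t. - E t)"
        by (intro continuous_intros continuous_on_subset[OF cont]) auto
      show "((\<lambda>t. - E t) has_vector_derivative - E' t) (at t)" if "t \<in> {0<..<real n}" for t
        using deriv[of t] that
        by (auto simp: has_real_derivative_iff_has_vector_derivative
            intro!: has_vector_derivative_minus)
    qed simp
    then have "((\<lambda>t. - E' t) has_integral (E 0 - E (real n))) {0<..<real n}"
      by (simp add: has_integral_Icc_iff_Ioo)
    then have "(\<integral>\<^sup>+t. ennreal (- E' t) * indicator {0<..<real n} t \<partial>lborel)
        = ennreal (E 0 - E (real n))"
      by (rule nn_integral_has_integral_lebesgue'[rotated]) (use rate in force)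
    moreover have "(\<integral>\<^sup>+t. ennreal (H t) * indicator {0<..<real n} t \<partial>lborel)
        \<le> (\<integral>\<^sup>+t. ennreal (- E' t) * indicator {0<..<real n} t \<partial>lborel)"
      by (rule nn_integral_mono) (use rate in \<open>auto simp: H_def split: split_indicator
          intro!: ennreal_leI\<close>)
    moreover have "ennreal (E 0 - E (real n)) \<le> ennreal (E 0)"
      using nonneg[of "real n"] False by (intro ennreal_leI) auto
    ultimately show ?thesis by simp
  qed simp
  have "(\<lambda>n. \<integral>\<^sup>+t. ennreal (H t) * indicator {0<..<real n} t \<partial>lborel)
      \<longlonglongrightarrow> (\<integral>\<^sup>+t. ennreal (H t) \<partial>lborel)"
  proof (rule nn_integral_LIMSEQ)
    show "incseq (\<lambda>n t. ennreal (H t) * indicator {0<..<real n} t)"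
      by (auto simp: incseq_def le_fun_def split: split_indicator)
    show "(\<lambda>n. ennreal (H t) * indicator {0<..<real n} t) \<longlonglongrightarrow> ennreal (H t)" for t
    proof (rule tendsto_eventually)
      obtain N where N: "t < real N"
        using reals_Archimedean2 by blast
      show "\<forall>\<^sub>F n in sequentially. ennreal (H t) * indicator {0<..<real n} t = ennreal (H t)"
        using eventually_ge_at_top[of N]
        by eventually_elim (use N in \<open>auto simp: H_def split: split_indicator\<close>)
    qed
  qed simp
  then have total: "(\<integral>\<^sup>+t. ennreal (H t) \<partial>lborel) \<le> ennreal (E 0)"
    by (rule LIMSEQ_le_const2) (use bound in auto)
  have E0: "E 0 \<ge> 0"
  proof -
    have "(E \<longlongrightarrow> E 0) (at_right 0)"
      using cont by (auto simp: continuous_on_def intro: tendsto_within_subset)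
    then show ?thesis
      by (rule tendsto_lowerbound)
        (use nonneg in \<open>auto simp: eventually_at_right_field intro!: exI[of _ 1]\<close>)
  qed
  have H_nonneg: "H t \<ge> 0" for t
    using rate[of t] by (auto simp: H_def split: split_indicator)
  have int: "integrable lborel H"
    by (rule integrableI_nonneg)
      (use H_nonneg le_less_trans[OF total ennreal_less_top] in auto)
  have "integral\<^sup>L lborel H \<le> E 0"
    using E0 total by (rule integral_real_bounded)
  \<comment> \<open>\<open>h 0\<close> is unconstrained, but a single point does not affect the integral.\<close>
  have ext: "indicator {0..} t *\<^sub>R h t = H t + indicator {0} t * h 0" for t
    by (auto simp: H_def split: split_indicator)
  have pt: "integrable lborel (\<lambda>t. indicator {0::real} t * h 0)"
    by simp
  have pt0: "(LINT t|lborel. indicator {0::real} t * h 0) = 0"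
    by simp
  show "set_integrable lborel {0..} h"
    unfolding set_integrable_def ext using int pt by (rule Bochner_Integration.integrable_add)
  show "(LINT t:{0..}|lborel. h t) \<le> E 0"
    unfolding set_lebesgue_integral_def ext
    using Bochner_Integration.integral_add[OF int pt] pt0 \<open>integral\<^sup>L lborel H \<le> E 0\<close> by simp
qed

section \<open>The Lyapunov identity\<close>

text \<open>All cross terms cancel because \<open>A = a b\<close> turns \<open>A \<langle>g, X'\<rangle>\<close> into
  \<open>a \<langle>g, Z - X - c L\<^sup>-\<^sup>1 g\<rangle>\<close>, whose \<open>Z\<close> part is compensated by \<open>L Z' = - a g\<close>.\<close>

lemma energy_has_real_derivative:
  fixes f :: "'a::real_inner \<Rightarrow> real"
  assumes L: "positive_definite_op L"
    and f: "continuously_differentiable f"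
    and sol: "ode_solution a b c L f x0 X Z"
    and A: "A t = a t * b t" and dA: "(A has_real_derivative dA) (at t)" and "t > 0"
  shows "(energy A L f X Z xs has_real_derivative
      dA * (f (X t) - f xs) - a t * inner (grad f (X t)) (X t - xs)
        - a t * c t * (norm_op (inv L) (grad f (X t)))\<^sup>2) (at t)"
proof -
  define g where "g = grad f (X t)"
  define X' where "X' = vector_derivative X (at t)"
  define Z' where "Z' = vector_derivative Z (at t)"
  have blin: "bounded_linear L" and sym: "inner (L x) y = inner x (L y)" for x y
    using L by (auto simp: positive_definite_op_def)
  have X: "(X has_vector_derivative X') (at t)" and Z: "(Z has_vector_derivative Z') (at t)"
    using sol \<open>t > 0\<close> by (auto simp: ode_solution_def X'_def Z'_def vector_derivative_works)
  have Zt: "Z t = b t *\<^sub>R X' + c t *\<^sub>R inv L g + X t" and Z't: "Z' = - (a t *\<^sub>R inv L g)"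
    using sol \<open>t > 0\<close> unfolding ode_solution_def X'_def Z'_def g_def by blast+
  have LZ': "L Z' = - (a t *\<^sub>R g)"
    using bounded_linear.linear[OF blin]
    by (simp add: Z't linear_neg linear_scale positive_definite_op_inv[OF L])
  have fX: "((\<lambda>s. f (X s)) has_real_derivative inner g X') (at t)"
    unfolding g_def by (rule GDERIV_chain_real[OF GDERIV_grad[OF f] X])
  have Zxs: "((\<lambda>s. Z s - xs) has_vector_derivative Z') (at t)"
    using Z by (auto intro!: derivative_eq_intros)
  have "((\<lambda>s. inner (L (Z s - xs)) (Z s - xs)) has_derivative
      (\<lambda>h. inner (L (Z t - xs)) (h *\<^sub>R Z') + inner (L (h *\<^sub>R Z')) (Z t - xs))) (at t)"
    using Zxs unfolding has_vector_derivative_def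
    by (intro has_derivative_inner bounded_linear.has_derivative[OF blin])
  moreover have "(\<lambda>h. inner (L (Z t - xs)) (h *\<^sub>R Z') + inner (L (h *\<^sub>R Z')) (Z t - xs))
      = (*) (2 * inner (L Z') (Z t - xs))"
    using sym[of "Z t - xs" Z'] bounded_linear.linear[OF blin]
    by (auto simp: linear_scale inner_commute[of "Z t - xs"])
  ultimately have N: "((\<lambda>s. (norm_op L (Z s - xs))\<^sup>2) has_real_derivative
      2 * inner (L Z') (Z t - xs)) (at t)"
    by (simp add: has_field_derivative_def norm_op_sq[OF L])
  have "(energy A L f X Z xs has_real_derivative
      dA * (f (X t) - f xs) + A t * inner g X' + inner (L Z') (Z t - xs)) (at t)"
    unfolding energy_def[abs_def]
    by (rule derivative_eq_intros dA fX N refl | simp)+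
  moreover have "A t * inner g X' + inner (L Z') (Z t - xs)
      = - (a t * inner g (X t - xs)) - a t * c t * inner (inv L g) g"
    unfolding LZ' Zt A by (simp add: algebra_simps inner_commute)
  then have "dA * (f (X t) - f xs) + A t * inner g X' + inner (L Z') (Z t - xs)
      = dA * (f (X t) - f xs) - a t * inner (grad f (X t)) (X t - xs)
        - a t * c t * (norm_op (inv L) (grad f (X t)))\<^sup>2"
    by (simp add: g_def[symmetric] norm_op_inv_sq[OF L])
  ultimately show ?thesis
    by (rule DERIV_cong)
qed

section \<open>Convergence rate and integral bounds\<close>

theorem theorem1:
  fixes f :: "'a::{real_inner, complete_space} \<Rightarrow> real"
    and L :: "'a \<Rightarrow> 'a"
    and a b c A A' :: "real \<Rightarrow> real"
    and X Z :: "real \<Rightarrow> 'a"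
    and x0 :: 'a
  assumes L: "positive_definite_op L"
    and f_Gamma0: "(\<lambda>x. ereal (f x)) \<in> Gamma0"
    and f_C1: "continuously_differentiable f"
    and minimizers_nonempty: "minimizers f \<noteq> {}"
    and coeffs_pos: "\<forall>t>0. a t > 0 \<and> b t > 0 \<and> c t > 0"
    and coeffs_0: "a 0 \<ge> 0" "b 0 \<ge> 0" "c 0 \<ge> 0"
    and solution: "ode_solution a b c L f x0 X Z"
    and A: "\<forall>t\<ge>0. A t = a t * b t"
    and A_deriv: "\<forall>t\<ge>0. (A has_real_derivative A' t) (at t within {0..})"
    and A'_bounds: "\<forall>t\<ge>0. 0 \<le> A' t \<and> A' t \<le> a t"
  shows "(\<forall>xs \<in> minimizers f. antimono_on {0..} (energy A L f X Z xs))
    \<and> (\<forall>t>0. f (X t) - min_value f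
          \<le> A 0 / A t * (f x0 - min_value f) + (dist_op L x0 (minimizers f))\<^sup>2 / (2 * A t))
    \<and> (\<forall>xs \<in> minimizers f.
          set_integrable lborel {0..} (\<lambda>t. (a t - A' t) * inner (grad f (X t)) (X t - xs))
          \<and> (LINT t:{0..}|lborel. (a t - A' t) * inner (grad f (X t)) (X t - xs))
              \<le> A 0 * (f x0 - min_value f) + 1 / 2 * (norm_op L (x0 - xs))\<^sup>2)
    \<and> set_integrable lborel {0..} (\<lambda>t. a t * c t * (norm_op (inv L) (grad f (X t)))\<^sup>2)
    \<and> (LINT t:{0..}|lborel. a t * c t * (norm_op (inv L) (grad f (X t)))\<^sup>2)
        \<le> A 0 * (f x0 - min_value f) + 1 / 2 * (dist_op L x0 (minimizers f))\<^sup>2"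
proof -
  define g where "g t = grad f (X t)" for t
  define G where "G t = (norm_op (inv L) (g t))\<^sup>2" for t
  define X' where "X' t = vector_derivative X (at t)" for t
  define Z' where "Z' t = vector_derivative Z (at t)" for t
  have G: "G t = inner (inv L (g t)) (g t)" for t
    by (simp add: G_def norm_op_inv_sq[OF L])
  have blin: "bounded_linear L"
    using L by (simp add: positive_definite_op_def)
  have contX: "continuous_on {0..} X" and contZ: "continuous_on {0..} Z"
    and init: "X 0 = x0" "Z 0 = x0"
    using solution by (auto simp: ode_solution_def)
  have X: "(X has_vector_derivative X' t) (at t)" and Z: "(Z has_vector_derivative Z' t) (at t)"
    if "t > 0" for t
    using solution that by (auto simp: ode_solution_def X'_def Z'_def vector_derivative_works)
  have Zt: "Z t = b t *\<^sub>R X' t + c t *\<^sub>R inv L (g t) + X t"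
    and Z't: "Z' t = - (a t *\<^sub>R inv L (g t))" if "t > 0" for t
    using solution that unfolding ode_solution_def X'_def Z'_def g_def by blast+
  have LZ': "L (Z' t) = - (a t *\<^sub>R g t)" if "t > 0" for t
    using bounded_linear.linear[OF blin]
    by (simp add: Z't[OF that] linear_neg linear_scale positive_definite_op_inv[OF L])
  have fX: "((\<lambda>s. f (X s)) has_real_derivative inner (g t) (X' t)) (at t)" if "t > 0" for t
    unfolding g_def by (rule GDERIV_chain_real[OF GDERIV_grad[OF f_C1] X[OF that]])
  have contA: "continuous_on {0..} A"
    using A_deriv by (auto simp: continuous_on_eq_continuous_within
        intro: DERIV_continuous)
  have dA: "(A has_real_derivative A' t) (at t)" if "t > 0" for t
  proof -
    have "at t within {0..} = at t"
      by (rule at_within_interior) (use that in simp)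
    then show ?thesis
      using A_deriv that by (metis less_imp_le)
  qed
  have contf: "continuous_on UNIV f"
    using GDERIV_grad[OF f_C1] unfolding gderiv_def
    by (auto intro!: continuous_at_imp_continuous_on has_derivative_continuous)
  have contE: "continuous_on {0..} (energy A L f X Z xs)" for xs
    unfolding energy_def[abs_def] norm_op_sq[OF L]
    by (intro continuous_intros contA contX contZ continuous_on_compose2[OF contf contX]
        bounded_linear.continuous_on[OF blin]) auto
  have contg: "continuous_on {0..} g"
    unfolding g_def
    by (rule continuous_on_compose2[OF _ contX])
      (use f_C1 in \<open>auto simp: continuously_differentiable_def\<close>)
  note cont_pos = contA[THEN continuous_on_subset] contX[THEN continuous_on_subset]
    contZ[THEN continuous_on_subset] contg[THEN continuous_on_subset]

  have A_pos: "A t > 0" if "t > 0" for t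
    using A coeffs_pos that by simp
  have G_nonneg: "a t * c t * G t \<ge> 0" if "t > 0" for t
    using coeffs_pos that by (simp add: G_def less_imp_le)

  have tangent: "inner (g t) (X t - xs) \<ge> f (X t) - f xs" for t xs
    using convex_above_tangent_GDERIV[OF Gamma0_real_convex[OF f_Gamma0] GDERIV_grad[OF f_C1],
        of "X t" xs]
    by (simp add: g_def inner_diff_right)

  \<comment> \<open>The dissipation rate is a sum of three nonnegative terms: the first two because
    \<open>0 \<le> A' \<le> a\<close> and \<open>\<langle>g, X - x\<^sup>*\<rangle> \<ge> f(X) - f(x\<^sup>*) \<ge> 0\<close>.\<close>
  define E' where "E' xs t = A' t * (f (X t) - f xs) - a t * inner (g t) (X t - xs)
    - a t * c t * G t" for xs t
  have dE: "(energy A L f X Z xs has_real_derivative E' xs t) (at t)" if "t > 0" for xs t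
    unfolding E'_def g_def G_def
    by (rule energy_has_real_derivative[OF L f_C1 solution _ dA]) (use A that in auto)
  have split: "- E' xs t = A' t * (inner (g t) (X t - xs) - (f (X t) - f xs))
      + (a t - A' t) * inner (g t) (X t - xs) + a t * c t * G t" for xs t
    by (simp add: E'_def algebra_simps)
  have terms: "A' t * (inner (g t) (X t - xs) - (f (X t) - f xs)) \<ge> 0"
      "(a t - A' t) * inner (g t) (X t - xs) \<ge> 0" if "xs \<in> minimizers f" "t > 0" for xs t
  proof -
    have "f xs \<le> f (X t)"
      using that by (simp add: minimizers_def)
    then have "inner (g t) (X t - xs) \<ge> 0"
      using tangent[of t xs] by linarith
    then show "A' t * (inner (g t) (X t - xs) - (f (X t) - f xs)) \<ge> 0"
        "(a t - A' t) * inner (g t) (X t - xs) \<ge> 0"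
      using A'_bounds that tangent[of t xs] by auto
  qed
  have E_nonneg: "energy A L f X Z xs t \<ge> 0" if "xs \<in> minimizers f" "t > 0" for xs t
    using that A_pos[of t] by (simp add: energy_def minimizers_def)

  have decreasing: "energy A L f X Z xs t \<le> energy A L f X Z xs s"
    if "xs \<in> minimizers f" "0 \<le> s" "s \<le> t" for xs s t
  proof (rule DERIV_nonpos_imp_decreasing_open[OF \<open>s \<le> t\<close>])
    show "\<exists>y. (energy A L f X Z xs has_real_derivative y) (at u) \<and> y \<le> 0"
      if "s < u" "u < t" for u
    proof (intro exI conjI)
      have u: "u > 0"
        using that \<open>0 \<le> s\<close> by simp
      show "(energy A L f X Z xs has_real_derivative E' xs u) (at u)"
        by (rule dE[OF u])
      show "E' xs u \<le> 0"
        using split[of xs u] terms[OF \<open>xs \<in> minimizers f\<close> u] G_nonneg[OF u] by linarith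
    qed
    show "continuous_on {s..t} (energy A L f X Z xs)"
      by (rule continuous_on_subset[OF contE]) (use that in auto)
  qed
  have E0: "energy A L f X Z xs 0 = A 0 * (f x0 - min_value f) + 1 / 2 * (norm_op L (x0 - xs))\<^sup>2"
    if "xs \<in> minimizers f" for xs
    using min_value_eq[OF that] by (simp add: energy_def init)

  have rate: "f (X t) - min_value f
      \<le> A 0 / A t * (f x0 - min_value f) + (dist_op L x0 (minimizers f))\<^sup>2 / (2 * A t)"
    if t: "t > 0" for t
  proof -
    have "2 * (A t * (f (X t) - min_value f) - A 0 * (f x0 - min_value f))
        \<le> (dist_op L x0 (minimizers f))\<^sup>2"
    proof (rule le_dist_op_sq[OF L minimizers_nonempty])
      fix xs assume xs: "xs \<in> minimizers f"
      have "A t * (f (X t) - min_value f) \<le> energy A L f X Z xs t"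
        using min_value_eq[OF xs] by (simp add: energy_def)
      also have "\<dots> \<le> energy A L f X Z xs 0"
        using decreasing[OF xs] t by simp
      finally show "2 * (A t * (f (X t) - min_value f) - A 0 * (f x0 - min_value f))
          \<le> (norm_op L (x0 - xs))\<^sup>2"
        using E0[OF xs] by simp
    qed
    then have "f (X t) - min_value f
        \<le> (A 0 * (f x0 - min_value f) + (dist_op L x0 (minimizers f))\<^sup>2 / 2) / A t"
      using A_pos[OF t] by (simp add: pos_le_divide_eq mult.commute)
    then show ?thesis
      by (simp add: add_divide_distrib)
  qed

  \<comment> \<open>Rewriting through \<open>L Z'\<close>, \<open>A'\<close> and \<open>(f \<circ> X)'\<close> removes the arbitrary coefficients
    from the integrands.\<close>
  have measLZ': "(\<lambda>t. indicator {0<..} t * inner (L (Z' t)) (w t)) \<in> borel_measurable borel"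
    if "continuous_on {0<..} w" for w
    using that
    by (rule borel_measurable_inner_derivative[rotated])
      (rule bounded_linear.has_vector_derivative[OF blin Z])
  have meas_grad: "(\<lambda>t. indicator {0<..} t * ((a t - A' t) * inner (g t) (X t - xs)))
      \<in> borel_measurable borel" for xs
  proof -
    have "(\<lambda>t. indicator {0<..} t * inner (A' t) (inner (g t) (X t - xs)))
        \<in> borel_measurable borel"
      by (rule borel_measurable_inner_derivative)
        (auto simp: has_real_derivative_iff_has_vector_derivative[symmetric]
          intro!: dA continuous_intros cont_pos)
    moreover have "(\<lambda>t. indicator {0<..} t * inner (L (Z' t)) (X t - xs))
        \<in> borel_measurable borel"
      by (rule measLZ') (auto intro!: continuous_intros cont_pos)
    ultimately have "(\<lambda>t. - (indicator {0<..} t * inner (L (Z' t)) (X t - xs))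
        - indicator {0<..} t * inner (A' t) (inner (g t) (X t - xs))) \<in> borel_measurable borel"
      by measurable
    then show ?thesis
      by (rule back_subst[of "\<lambda>F. F \<in> borel_measurable borel"])
        (auto simp: LZ' algebra_simps split: split_indicator)
  qed
  have meas_G: "(\<lambda>t. indicator {0<..} t * (a t * c t * G t)) \<in> borel_measurable borel"
  proof -
    have "(\<lambda>t. indicator {0<..} t * inner (inner (g t) (X' t)) (A t)) \<in> borel_measurable borel"
      by (rule borel_measurable_inner_derivative[where Y = "\<lambda>t. f (X t)"])
        (auto simp: has_real_derivative_iff_has_vector_derivative[symmetric]
          intro!: fX cont_pos)
    moreover have "(\<lambda>t. indicator {0<..} t * inner (L (Z' t)) (Z t - X t))
        \<in> borel_measurable borel"
      by (rule measLZ') (auto intro!: continuous_intros cont_pos)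
    ultimately have "(\<lambda>t. - (indicator {0<..} t * inner (L (Z' t)) (Z t - X t))
        - indicator {0<..} t * inner (inner (g t) (X' t)) (A t)) \<in> borel_measurable borel"
      by measurable
    moreover have "- inner (L (Z' t)) (Z t - X t) - inner (inner (g t) (X' t)) (A t)
        = a t * c t * G t" if "t > 0" for t
      using that A by (simp add: LZ' Zt[OF that] G algebra_simps inner_commute)
    ultimately show ?thesis
      by (elim back_subst[of "\<lambda>F. F \<in> borel_measurable borel"])
        (auto split: split_indicator)
  qed

  have grad_integral: "set_integrable lborel {0..} (\<lambda>t. (a t - A' t) * inner (g t) (X t - xs))"
    "(LINT t:{0..}|lborel. (a t - A' t) * inner (g t) (X t - xs)) \<le> energy A L f X Z xs 0"
    if "xs \<in> minimizers f" for xs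
  proof -
    have "0 \<le> (a t - A' t) * inner (g t) (X t - xs)
        \<and> (a t - A' t) * inner (g t) (X t - xs) \<le> - E' xs t" if "t > 0" for t
      using split[of xs t] terms[OF \<open>xs \<in> minimizers f\<close> that] G_nonneg[OF that] by linarith
    from dissipation_integral_bound[OF contE dE E_nonneg[OF that] this meas_grad]
    show "set_integrable lborel {0..} (\<lambda>t. (a t - A' t) * inner (g t) (X t - xs))"
      "(LINT t:{0..}|lborel. (a t - A' t) * inner (g t) (X t - xs)) \<le> energy A L f X Z xs 0"
      by blast+
  qed
  have G_integral: "set_integrable lborel {0..} (\<lambda>t. a t * c t * G t)"
    "(LINT t:{0..}|lborel. a t * c t * G t) \<le> energy A L f X Z xs 0"
    if "xs \<in> minimizers f" for xs
  proof -
    have "0 \<le> a t * c t * G t \<and> a t * c t * G t \<le> - E' xs t" if "t > 0" for t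
      using split[of xs t] terms[OF \<open>xs \<in> minimizers f\<close> that] G_nonneg[OF that] by linarith
    from dissipation_integral_bound[OF contE dE E_nonneg[OF that] this meas_G]
    show "set_integrable lborel {0..} (\<lambda>t. a t * c t * G t)"
      "(LINT t:{0..}|lborel. a t * c t * G t) \<le> energy A L f X Z xs 0"
      by blast+
  qed
  have "2 * ((LINT t:{0..}|lborel. a t * c t * G t) - A 0 * (f x0 - min_value f))
      \<le> (dist_op L x0 (minimizers f))\<^sup>2"
  proof (rule le_dist_op_sq[OF L minimizers_nonempty])
    fix xs assume xs: "xs \<in> minimizers f"
    show "2 * ((LINT t:{0..}|lborel. a t * c t * G t) - A 0 * (f x0 - min_value f))
        \<le> (norm_op L (x0 - xs))\<^sup>2"
      using G_integral(2)[OF xs] E0[OF xs] by simp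
  qed
  then have G_bound: "(LINT t:{0..}|lborel. a t * c t * G t)
      \<le> A 0 * (f x0 - min_value f) + 1 / 2 * (dist_op L x0 (minimizers f))\<^sup>2"
    by simp
  have "\<forall>xs\<in>minimizers f. antimono_on {0..} (energy A L f X Z xs)"
    using decreasing by (auto intro!: monotone_onI)
  moreover have "set_integrable lborel {0..} (\<lambda>t. a t * c t * G t)"
    using minimizers_nonempty G_integral(1) by blast
  ultimately show ?thesis
    using rate grad_integral E0 G_bound unfolding G_def g_def by simp
qed

end
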